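(* Let $k\ge 2$. For any $k$-monotone probability $f$ on $\mathbb{N}$, $$\|f-\hat p\|_2\le \|f-\tilde p\|_2,$$ and if $\tilde p$ is not $k$-monotone, then the inequality is strict. Moreover, if the distribution $p$ of the observations is $k$-monotone and if there exists $i\in\mathbb{N}$ such that $\Delta^k p(i)=0$, then for every $k$-monotone probability $f$ on $\mathbb{N}$, $$\liminf_{n\to\infty}\ \mathbb{P}\big(\|f-\hat p\|_2<\|f-\tilde p\|_2\big)\ge \tfrac12 .$$
   Context: $\mathbb{N}=\{0,1,2,\dots\}$. For a real sequence $f=(f(i))_{i\in\mathbb{N}}$, put $\Delta^1 f(i)=f(i+1)-f(i)$ and $\Delta^{k}f(i)=\Delta^{k-1}f(i+1)-\Delta^{k-1}f(i)$. The sequence $f$ is $k$-monotone if $(-1)^k\Delta^k f(i)\ge 0$ for all $i\in\mathbb{N}$. A $k$-monotone probability is a probability mass function on $\mathbb{N}$ that is $k$-monotone; $\mathcal{P}^k$ is the set of these. $\|g\|_2^2=\sum_{i\ge 0}g(i)^2$. $X_1,\dots,X_n$ are i.i.d. with probability mass function $p$ on $\mathbb{N}$, $\tilde p(j)=\frac1n\sum_{i=1}^n \mathbb{I}_{\{X_i=j\}}$ is the empirical probability mass function, and $\hat p=\operatorname{argmin}\{\|f-\tilde p\|_2^2 : f\in\mathcal{P}^k\}$ (this minimizer exists and is unique). Both $\tilde p$ and $\hat p$ depend on $n$.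
   Formalization: In the second part, the i with Δ^k p(i)=0 is required to lie in the support of p (p(i)>0); otherwise the claim is false, e.g. for p the point mass at 0, where Δ^k p(1)=0 but p̂=p̃ always. *)

theory Defs
  imports "HOL-Probability.Probability"
begin

primrec fdiff :: "nat \<Rightarrow> (nat \<Rightarrow> real) \<Rightarrow> nat \<Rightarrow> real" where
  "fdiff 0 f = f"
| "fdiff (Suc k) f = (\<lambda>i. fdiff k f (i + 1) - fdiff k f i)"

definition k_monotone :: "nat \<Rightarrow> (nat \<Rightarrow> real) \<Rightarrow> bool" where
  "k_monotone k f \<longleftrightarrow> (\<forall>i. (- 1) ^ k * fdiff k f i \<ge> 0)"

definition k_monotone_pmfs :: "nat \<Rightarrow> nat pmf set" where
  "k_monotone_pmfs k = {q. k_monotone k (pmf q)}"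

(* suminf carries no information for divergent series; this norm is only applied to differences of
   two probability mass functions, which are square summable. *)
definition l2norm :: "(nat \<Rightarrow> real) \<Rightarrow> real" where
  "l2norm g = sqrt (\<Sum>i. (g i)\<^sup>2)"

(* The observations are x 0, ..., x (n - 1). *)
definition empirical :: "nat \<Rightarrow> (nat \<Rightarrow> nat) \<Rightarrow> nat \<Rightarrow> real" where
  "empirical n x j = (1 / real n) * (\<Sum>i<n. of_bool (x i = j))"

(* For n > 0 the minimizer exists and is unique, so the choice operator inside arg_min_on
   selects the least-squares projection. *)
definition k_monotone_lse :: "nat \<Rightarrow> nat \<Rightarrow> (nat \<Rightarrow> nat) \<Rightarrow> nat pmf" where
  "k_monotone_lse k n x =
     arg_min_on (\<lambda>q. (l2norm (\<lambda>j. pmf q j - empirical n x j))\<^sup>2) (k_monotone_pmfs k)"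

end

theory Submission imports Defs begin

text \<open>The estimator projects the empirical distribution onto a convex set, so the obtuse angle at the
  projection gives the Pythagorean inequality
  \<open>\<parallel>f - h\<parallel>\<^sup>2 + \<parallel>h - e\<parallel>\<^sup>2 \<le> \<parallel>f - e\<parallel>\<^sup>2\<close>, where \<open>e\<close> is the empirical distribution and
  \<open>h\<close> its projection; so the projection is strictly closer to \<open>f\<close> as soon as \<open>e\<close> is not \<open>k\<close>-monotone. When the
  \<open>k\<close>-th difference of \<open>p\<close> vanishes at a point, the central limit theorem shows that \<open>e\<close> violates
  the sign condition there with asymptotic probability at least one half.\<close>

section \<open>Square-summable sequences and least squares over midpoint-convex sets\<close>

lemma summable_mult_of_square_summable:
  fixes f g :: "nat \<Rightarrow> real"
  assumes "summable (\<lambda>i. (f i)\<^sup>2)" "summable (\<lambda>i. (g i)\<^sup>2)"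
  shows "summable (\<lambda>i. f i * g i)"
proof (rule summable_comparison_test')
  show "summable (\<lambda>i. (f i)\<^sup>2 + (g i)\<^sup>2)"
    using assms by (rule summable_add)
  show "norm (f i * g i) \<le> (f i)\<^sup>2 + (g i)\<^sup>2" for i
  proof -
    have "2 * (\<bar>f i\<bar> * \<bar>g i\<bar>) \<le> (f i)\<^sup>2 + (g i)\<^sup>2"
      using sum_squares_bound[of "\<bar>f i\<bar>" "\<bar>g i\<bar>"] by (simp add: mult.assoc)
    moreover have "0 \<le> \<bar>f i\<bar> * \<bar>g i\<bar>" by simp
    ultimately have "\<bar>f i\<bar> * \<bar>g i\<bar> \<le> (f i)\<^sup>2 + (g i)\<^sup>2" by linarith
    then show ?thesis by (simp add: abs_mult)
  qed
qed

text \<open>One expansion serves three ranges of \<open>t\<close>: small positive \<open>t\<close>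
  for first-order optimality, \<open>t = -1\<close> for differences, \<open>t = 1\<close> for the
  Pythagorean inequality.\<close>

lemma sums_square_add_scaled:
  fixes f g :: "nat \<Rightarrow> real"
  assumes f: "summable (\<lambda>i. (f i)\<^sup>2)" and g: "summable (\<lambda>i. (g i)\<^sup>2)"
  shows "(\<lambda>i. (f i + t * g i)\<^sup>2) sums
    ((\<Sum>i. (f i)\<^sup>2) + 2 * t * (\<Sum>i. f i * g i) + t\<^sup>2 * (\<Sum>i. (g i)\<^sup>2))"
proof -
  have "(\<lambda>i. (f i)\<^sup>2 + 2 * t * (f i * g i) + t\<^sup>2 * (g i)\<^sup>2) sums
    ((\<Sum>i. (f i)\<^sup>2) + 2 * t * (\<Sum>i. f i * g i) + t\<^sup>2 * (\<Sum>i. (g i)\<^sup>2))"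
    by (intro sums_add sums_mult summable_sums f g summable_mult_of_square_summable)
  then show ?thesis
    by (simp add: power2_eq_square algebra_simps)
qed

lemma summable_square_diff:
  fixes f g :: "nat \<Rightarrow> real"
  assumes "summable (\<lambda>i. (f i)\<^sup>2)" "summable (\<lambda>i. (g i)\<^sup>2)"
  shows "summable (\<lambda>i. (f i - g i)\<^sup>2)"
  using sums_square_add_scaled[OF assms, of "-1"] by (simp add: sums_iff)

lemma summable_square_of_summable_nonneg:
  fixes f :: "nat \<Rightarrow> real"
  assumes "summable f" "\<And>i. 0 \<le> f i"
  shows "summable (\<lambda>i. (f i)\<^sup>2)"
proof (rule summable_comparison_test')
  show "summable (\<lambda>i. suminf f * f i)"
    using assms(1) by (rule summable_mult)
  show "norm ((f i)\<^sup>2) \<le> suminf f * f i" for i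
    using sum_le_suminf[of f "{i}"] assms by (auto simp: power2_eq_square intro!: mult_right_mono)
qed

text \<open>The squared norm grows by 2t times the inner product plus t^2 times the squared norm of
  \<open>u\<close>; divide by 2t and let t tend to 0 from the right. The one-sided range fits
  perturbations that stay in a constraint set only for small t > 0.\<close>

lemma first_order_optimality:
  fixes u v :: "nat \<Rightarrow> real"
  assumes v: "summable (\<lambda>i. (v i)\<^sup>2)" and u: "summable (\<lambda>i. (u i)\<^sup>2)" and "0 < \<delta>"
    and min: "\<And>t. 0 < t \<Longrightarrow> t \<le> \<delta> \<Longrightarrow> (\<Sum>i. (v i)\<^sup>2) \<le> (\<Sum>i. (v i + t * u i)\<^sup>2)"
  shows "0 \<le> (\<Sum>i. v i * u i)"
proof (rule tendsto_lowerbound)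
  let ?U = "\<Sum>i. (u i)\<^sup>2" and ?VU = "\<Sum>i. v i * u i"
  show "((\<lambda>t. ?VU + t / 2 * ?U) \<longlongrightarrow> ?VU) (at_right 0)"
    by (auto intro!: tendsto_eq_intros)
  have "0 \<le> ?VU + t / 2 * ?U" if "t \<in> {0<..<\<delta>}" for t
  proof -
    have "0 \<le> 2 * t * ?VU + t\<^sup>2 * ?U"
      using min[of t] sums_square_add_scaled[OF v u, of t] that by (simp add: sums_iff)
    also have "\<dots> = (2 * t) * (?VU + t / 2 * ?U)"
      by (simp add: power2_eq_square algebra_simps)
    finally show ?thesis
      using that by (simp add: zero_le_mult_iff)
  qed
  then show "\<forall>\<^sub>F t in at_right 0. 0 \<le> ?VU + t / 2 * ?U"
    using eventually_at_right_real[OF \<open>0 < \<delta>\<close>] by (auto elim: eventually_mono)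
qed simp

text \<open>By the parallelogram law a minimizing sequence is Cauchy in every coordinate. This
  yields a pointwise limit, which is why closedness is stated pointwise, and the limit attains the
  infimum by lower semicontinuity.\<close>

lemma least_squares_minimizer_exists:
  fixes e :: "nat \<Rightarrow> real"
  assumes ne: "K \<noteq> {}" and sq: "\<And>f. f \<in> K \<Longrightarrow> summable (\<lambda>i. (f i - e i)\<^sup>2)"
    and mid: "\<And>f g. f \<in> K \<Longrightarrow> g \<in> K \<Longrightarrow> (\<lambda>i. (f i + g i) / 2) \<in> K"
    and closed: "\<And>F q. (\<And>m::nat. F m \<in> K) \<Longrightarrow> (\<And>i. (\<lambda>m. F m i) \<longlonglongrightarrow> q i) \<Longrightarrow> q \<in> K"
  shows "\<exists>q\<in>K. \<forall>f\<in>K. (\<Sum>i. (q i - e i)\<^sup>2) \<le> (\<Sum>i. (f i - e i)\<^sup>2)"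
proof -
  define N where "N f = (\<Sum>i. (f i - e i)\<^sup>2)" for f
  define d where "d = (INF f\<in>K. N f)"
  have N_nonneg: "0 \<le> N f" if "f \<in> K" for f
    unfolding N_def using sq[OF that] by (intro suminf_nonneg) auto
  then have bdd: "bdd_below (N ` K)"
    by (auto intro!: bdd_belowI[of _ 0])
  have d_le: "d \<le> N f" if "f \<in> K" for f
    unfolding d_def by (rule cINF_lower[OF bdd that])
  have "\<exists>f\<in>K. N f < d + 1 / Suc m" for m
    using cINF_less_iff[OF ne bdd, of "d + 1 / Suc m"] by (auto simp: d_def)
  then obtain F where FK: "F m \<in> K" and FN: "N (F m) < d + 1 / Suc m" for m
    by metis
  \<comment> \<open>The midpoint of \<open>f\<close> and \<open>g\<close> lies in \<open>K\<close>,
    so its \<open>N\<close> is at least \<open>d\<close>; a single coordinate is bounded by the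
    whole series.\<close>
  have parallelogram: "(f i - g i)\<^sup>2 \<le> 2 * N f + 2 * N g - 4 * d" if "f \<in> K" "g \<in> K" for f g i
  proof -
    have "(\<lambda>j. 2 * (f j - e j)\<^sup>2 + 2 * (g j - e j)\<^sup>2 - 4 * ((f j + g j) / 2 - e j)\<^sup>2) sums
      (2 * N f + 2 * N g - 4 * N (\<lambda>i. (f i + g i) / 2))"
      unfolding N_def by (intro sums_add sums_diff sums_mult summable_sums sq mid that)
    also have "(\<lambda>j. 2 * (f j - e j)\<^sup>2 + 2 * (g j - e j)\<^sup>2 - 4 * ((f j + g j) / 2 - e j)\<^sup>2)
      = (\<lambda>j. (f j - g j)\<^sup>2)"
      by (simp add: fun_eq_iff power2_eq_square field_simps)
    finally have "(f i - g i)\<^sup>2 \<le> 2 * N f + 2 * N g - 4 * N (\<lambda>i. (f i + g i) / 2)"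
      using sum_le_suminf[of "\<lambda>j. (f j - g j)\<^sup>2" "{i}"] by (simp add: sums_iff)
    with d_le[OF mid[OF that]] show ?thesis by simp
  qed
  have "Cauchy (\<lambda>m. F m i)" for i
  proof (rule CauchyI)
    fix \<epsilon> :: real assume "0 < \<epsilon>"
    \<comment> \<open>Both values of \<open>N\<close> will be below d + 1/(M+1), so
      \<open>parallelogram\<close> bounds the squared gap by 4/(M+1).\<close>
    then obtain M where M: "1 / real (Suc M) < \<epsilon>\<^sup>2 / 4"
      using nat_approx_posE[of "\<epsilon>\<^sup>2 / 4"] by auto
    have "norm (F m i - F l i) < \<epsilon>" if "m \<ge> M" "l \<ge> M" for m l
    proof -
      have "1 / real (Suc m) \<le> 1 / real (Suc M)" "1 / real (Suc l) \<le> 1 / real (Suc M)"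
        using that by (auto simp: field_simps)
      then have "(F m i - F l i)\<^sup>2 < \<epsilon>\<^sup>2"
        using parallelogram[OF FK FK, of m i l] FN[of m] FN[of l] M by linarith
      then show ?thesis
        using \<open>0 < \<epsilon>\<close> power2_less_imp_less[of "\<bar>F m i - F l i\<bar>" \<epsilon>] by simp
    qed
    then show "\<exists>M. \<forall>m\<ge>M. \<forall>n\<ge>M. norm (F m i - F n i) < \<epsilon>" by blast
  qed
  then have "\<forall>i. \<exists>l. (\<lambda>m. F m i) \<longlonglongrightarrow> l"
    using Cauchy_convergent unfolding convergent_def by blast
  from choice[OF this] obtain q where lim: "(\<lambda>m. F m i) \<longlonglongrightarrow> q i" for i
    by blast
  have "q \<in> K"
    using closed[OF FK lim] .
  \<comment> \<open>A Fatou argument: each finite partial sum passes to the limit in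
    \<open>m\<close> while staying below d + 1/(m+1).\<close>
  moreover have "N q \<le> d"
    unfolding N_def
  proof (rule suminf_le_const[OF sq[OF \<open>q \<in> K\<close>]])
    fix n
    have "(\<lambda>m. d + 1 / real (Suc m)) \<longlonglongrightarrow> d + 0"
      by (intro tendsto_intros LIMSEQ_Suc lim_1_over_n)
    moreover have "(\<lambda>m. \<Sum>i<n. (F m i - e i)\<^sup>2) \<longlonglongrightarrow> (\<Sum>i<n. (q i - e i)\<^sup>2)"
      by (intro tendsto_intros lim)
    moreover have "(\<Sum>i<n. (F m i - e i)\<^sup>2) \<le> d + 1 / real (Suc m)" for m
      using sum_le_suminf[OF sq[OF FK], of "{..<n}" m] FN[of m] by (simp add: N_def)
    ultimately show "(\<Sum>i<n. (q i - e i)\<^sup>2) \<le> d"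
      by (auto intro: LIMSEQ_le)
  qed
  ultimately show ?thesis
    using d_le unfolding N_def by (meson order_trans)
qed

section \<open>Finite differences and k-monotone sequences\<close>

lemma fdiff_lincomb: "fdiff k (\<lambda>j. a * f j + b * g j) i = a * fdiff k f i + b * fdiff k g i"
  by (induction k arbitrary: i) (simp_all add: algebra_simps)

lemma fdiff_sum: "fdiff k (\<lambda>j. \<Sum>m\<in>A. f m j) i = (\<Sum>m\<in>A. fdiff k (f m) i)"
  by (induction k arbitrary: i) (simp_all add: sum_subtractf)

text \<open>Geometric sequences are eigenvectors of the difference operator, with eigenvalue
  \<open>r - 1\<close>.\<close>

lemma fdiff_power: "fdiff k (\<lambda>j. r ^ j) i = (r - 1) ^ k * r ^ i"
  by (induction k arbitrary: i) (simp_all add: algebra_simps)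

lemma tendsto_fdiff:
  assumes "\<And>j. ((\<lambda>m. F m j) \<longlongrightarrow> f j) G"
  shows "((\<lambda>m. fdiff k (F m) i) \<longlongrightarrow> fdiff k f i) G"
  by (induction k arbitrary: i) (auto intro!: tendsto_diff assms)

text \<open>Each difference at most doubles a uniform bound. This later provides the second moment
  for the central limit theorem.\<close>

lemma abs_fdiff_le:
  assumes "\<And>j. \<bar>f j\<bar> \<le> c"
  shows "\<bar>fdiff k f i\<bar> \<le> 2 ^ k * c"
proof (induction k arbitrary: i)
  case (Suc k)
  from this[of i] this[of "i + 1"] show ?case by simp
qed (use assms in simp)

lemma integral_fdiff:
  assumes "\<And>j. integrable M (\<lambda>a. h a j)"
  shows "integrable M (\<lambda>a. fdiff k (h a) i) \<and>
    (\<integral>a. fdiff k (h a) i \<partial>M) = fdiff k (\<lambda>j. \<integral>a. h a j \<partial>M) i"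
  by (induction k arbitrary: i) (simp_all add: assms)

lemma fdiff_point_mass_right: "a < i \<Longrightarrow> fdiff k (\<lambda>j. of_bool (a = j)) i = 0"
  by (induction k arbitrary: i) auto

text \<open>Of the entries i, ..., i+k that enter the difference, only the first sees the mass, with
  coefficient (-1)^k. That this is nonzero later makes the variance positive.\<close>

lemma fdiff_point_mass_same: "fdiff k (\<lambda>j. of_bool (i = j)) i = (- 1) ^ k"
  by (induction k) (simp_all add: fdiff_point_mass_right)

lemma k_monotone_lincomb:
  assumes "k_monotone k f" "k_monotone k g" "0 \<le> a" "0 \<le> b"
  shows "k_monotone k (\<lambda>j. a * f j + b * g j)"
  unfolding k_monotone_def fdiff_lincomb
proof
  fix i
  have "0 \<le> a * ((- 1) ^ k * fdiff k f i) + b * ((- 1) ^ k * fdiff k g i)"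
    using assms by (auto simp: k_monotone_def)
  then show "0 \<le> (- 1) ^ k * (a * fdiff k f i + b * fdiff k g i)"
    by (simp add: algebra_simps)
qed

text \<open>The eigenvalue \<open>r - 1\<close> is at most 0, so its k-th power carries the sign
  (-1)^k or vanishes. For r < 1 these summable sequences are the directions along which missing mass
  is added.\<close>

lemma k_monotone_power:
  assumes "0 \<le> r" "r \<le> 1"
  shows "k_monotone k (\<lambda>j. r ^ j)"
proof -
  have "(- 1) ^ k * ((r - 1) ^ k * r ^ i) = (1 - r) ^ k * r ^ i" for i
    by (simp flip: mult.assoc power_mult_distrib)
  moreover have "0 \<le> (1 - r) ^ k * r ^ i" for i
    using assms by simp
  ultimately show ?thesis
    unfolding k_monotone_def fdiff_power by metis
qed

lemma k_monotone_limit: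
  assumes "\<And>m::nat. k_monotone k (F m)" "\<And>j. (\<lambda>m. F m j) \<longlonglongrightarrow> f j"
  shows "k_monotone k f"
  unfolding k_monotone_def
proof
  fix i
  have "(\<lambda>m. (- 1) ^ k * fdiff k (F m) i) \<longlonglongrightarrow> (- 1) ^ k * fdiff k f i"
    by (intro tendsto_mult_left tendsto_fdiff assms)
  then show "0 \<le> (- 1) ^ k * fdiff k f i"
    by (rule LIMSEQ_le_const) (use assms in \<open>auto simp: k_monotone_def\<close>)
qed

text \<open>Unlike the set of probabilities, this set is closed under pointwise limits, which can lose
  mass at infinity.\<close>

definition k_monotone_subpmfs :: "nat \<Rightarrow> (nat \<Rightarrow> real) set" where
  "k_monotone_subpmfs k = {q. k_monotone k q \<and> (\<forall>i. 0 \<le> q i) \<and> summable q \<and> suminf q \<le> 1}"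

lemma subpmfs_convex_comb:
  assumes "f \<in> k_monotone_subpmfs k" "g \<in> k_monotone_subpmfs k" "0 \<le> a" "0 \<le> b" "a + b = 1"
  shows "(\<lambda>j. a * f j + b * g j) \<in> k_monotone_subpmfs k"
proof -
  have "(\<lambda>j. a * f j + b * g j) sums (a * suminf f + b * suminf g)"
    using assms by (intro sums_add sums_mult summable_sums) (auto simp: k_monotone_subpmfs_def)
  moreover have "a * suminf f + b * suminf g \<le> a * 1 + b * 1"
    using assms by (intro add_mono mult_left_mono) (auto simp: k_monotone_subpmfs_def)
  ultimately show ?thesis
    using assms by (auto simp: k_monotone_subpmfs_def sums_iff intro!: k_monotone_lincomb)
qed

text \<open>Mass is controlled through finite partial sums, which converge termwise: the total may
  drop in the limit but cannot exceed 1.\<close>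

lemma subpmfs_limit:
  assumes F: "\<And>m::nat. F m \<in> k_monotone_subpmfs k" and lim: "\<And>j. (\<lambda>m. F m j) \<longlonglongrightarrow> f j"
  shows "f \<in> k_monotone_subpmfs k"
proof -
  have nn: "0 \<le> f j" for j
    by (rule LIMSEQ_le_const[OF lim]) (use F in \<open>auto simp: k_monotone_subpmfs_def\<close>)
  have le: "(\<Sum>j<n. f j) \<le> 1" for n
  proof (rule LIMSEQ_le_const2)
    show "(\<lambda>m. \<Sum>j<n. F m j) \<longlonglongrightarrow> (\<Sum>j<n. f j)"
      by (intro tendsto_sum lim)
    have "(\<Sum>j<n. F m j) \<le> 1" for m
    proof -
      have "(\<Sum>j<n. F m j) \<le> suminf (F m)"
        using F[of m] by (intro sum_le_suminf) (auto simp: k_monotone_subpmfs_def)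
      also have "\<dots> \<le> 1"
        using F[of m] by (simp add: k_monotone_subpmfs_def)
      finally show ?thesis .
    qed
    then show "\<exists>N. \<forall>m\<ge>N. (\<Sum>j<n. F m j) \<le> 1" by blast
  qed
  have sm: "summable f"
    by (rule summableI_nonneg_bounded[OF nn le])
  show ?thesis
    unfolding k_monotone_subpmfs_def
    using nn sm suminf_le_const[OF sm le] k_monotone_limit[OF _ lim, of k] F
    by (auto simp: k_monotone_subpmfs_def)
qed

lemma subpmfs_square_summable:
  "f \<in> k_monotone_subpmfs k \<Longrightarrow> summable (\<lambda>i. (f i)\<^sup>2)"
  by (rule summable_square_of_summable_nonneg) (auto simp: k_monotone_subpmfs_def)

section \<open>Existence of the projection among probabilities\<close>

lemma pmf_sums_one: "pmf q sums 1" for q :: "nat pmf"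
proof -
  have "(\<lambda>i. measure (measure_pmf q) {i}) sums measure (measure_pmf q) (\<Union>i. {i})"
    by (intro measure_pmf.finite_measure_UNION) (auto simp: disjoint_family_on_def)
  moreover have "(\<Union>i. {i}) = (UNIV :: nat set)" by auto
  ultimately show ?thesis
    by (simp add: measure_pmf_single)
qed

lemma pmf_in_subpmfs: "q \<in> k_monotone_pmfs k \<Longrightarrow> pmf q \<in> k_monotone_subpmfs k"
  using pmf_sums_one[of q] by (auto simp: k_monotone_pmfs_def k_monotone_subpmfs_def sums_iff)

lemma pmf_of_sums_one:
  fixes f :: "nat \<Rightarrow> real"
  assumes "\<And>i. 0 \<le> f i" "f sums 1"
  obtains q where "pmf q = f"
proof
  have "(\<integral>\<^sup>+ i. ennreal (f i) \<partial>count_space UNIV) = 1"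
    using assms by (simp add: nn_integral_count_space_nat suminf_ennreal2 sums_iff)
  then show "pmf (embed_pmf f) = f"
    using assms(1) by (simp add: fun_eq_iff pmf_embed_pmf)
qed

text \<open>If mass were missing, every small multiple of a geometric sequence of ratio \<open>r < 1\<close> could be
  added without leaving the set; optimality in these directions bounds the total mass of \<open>e\<close> by
  that of \<open>q\<close> as \<open>r\<close> tends to \<open>1\<close>.\<close>

lemma subpmf_minimizer_sums_one:
  assumes e0: "\<And>i. 0 \<le> e i" and e1: "e sums 1" and q: "q \<in> k_monotone_subpmfs k"
    and min: "\<And>f. f \<in> k_monotone_subpmfs k \<Longrightarrow> (\<Sum>i. (q i - e i)\<^sup>2) \<le> (\<Sum>i. (f i - e i)\<^sup>2)"
  shows "q sums 1"
proof -
  define c where "c = suminf q"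
  have qs: "q sums c" and q0: "\<And>i. 0 \<le> q i" and "k_monotone k q" and "c \<le> 1"
    using q by (auto simp: k_monotone_subpmfs_def c_def)
  have e_sq: "summable (\<lambda>i. (e i)\<^sup>2)"
    using e1 e0 by (intro summable_square_of_summable_nonneg) (auto simp: sums_iff)
  have "1 \<le> c"
  proof (rule ccontr)
    assume "\<not> 1 \<le> c"
    then have "c < 1" by simp
    have bound: "(\<Sum>i<n. e i * r ^ i) \<le> c" if r: "0 < r" "r < 1" for r :: real and n
    proof -
      have pow: "(\<lambda>i. r ^ i) sums (1 / (1 - r))"
        using r by (intro geometric_sums) simp
      have pow_sq: "summable (\<lambda>i. (r ^ i)\<^sup>2)"
        using pow r by (intro summable_square_of_summable_nonneg) (auto simp: sums_iff)
      have "0 \<le> (\<Sum>i. (q i - e i) * r ^ i)"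
      proof (rule first_order_optimality[OF _ pow_sq])
        show "summable (\<lambda>i. (q i - e i)\<^sup>2)"
          by (intro summable_square_diff e_sq subpmfs_square_summable[OF q])
        \<comment> \<open>This is the missing mass 1 - c divided by the total 1/(1-r) of the
          geometric sequence, hence the largest admissible multiple.\<close>
        show "0 < (1 - c) * (1 - r)"
          using \<open>c < 1\<close> r by simp
        fix t :: real assume t: "0 < t" "t \<le> (1 - c) * (1 - r)"
        have "(\<lambda>i. q i + t * r ^ i) sums (c + t * (1 / (1 - r)))"
          by (intro sums_add sums_mult qs pow)
        moreover have "c + t * (1 / (1 - r)) \<le> 1"
          using t r by (simp add: field_simps)
        moreover have "k_monotone k (\<lambda>i. q i + t * r ^ i)"
          using k_monotone_lincomb[OF \<open>k_monotone k q\<close> k_monotone_power[of r k], of 1 t] t r by simp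
        ultimately have "(\<lambda>i. q i + t * r ^ i) \<in> k_monotone_subpmfs k"
          using q0 t r by (auto simp: k_monotone_subpmfs_def sums_iff)
        from min[OF this] show "(\<Sum>i. (q i - e i)\<^sup>2) \<le> (\<Sum>i. (q i - e i + t * r ^ i)\<^sup>2)"
          by (simp add: algebra_simps)
      qed
      moreover have q_pow: "summable (\<lambda>i. q i * r ^ i)" and e_pow: "summable (\<lambda>i. e i * r ^ i)"
        by (intro summable_mult_of_square_summable subpmfs_square_summable[OF q] e_sq pow_sq)+
      ultimately have "(\<Sum>i. e i * r ^ i) \<le> (\<Sum>i. q i * r ^ i)"
        by (simp add: left_diff_distrib suminf_diff[symmetric])
      also have "\<dots> \<le> c"
        unfolding c_def
        using qs q_pow q0 r by (intro suminf_le) (auto simp: sums_iff intro!: mult_left_le power_le_one)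
      finally have "(\<Sum>i. e i * r ^ i) \<le> c" .
      moreover have "(\<Sum>i<n. e i * r ^ i) \<le> (\<Sum>i. e i * r ^ i)"
        using e_pow e0 r by (intro sum_le_suminf) auto
      ultimately show ?thesis by simp
    qed
    \<comment> \<open>A finite sum is a polynomial in \<open>r\<close>, so it is continuous at r =
      1; the passage to the full series comes afterwards.\<close>
    have "(\<Sum>i<n. e i) \<le> c" for n
    proof (rule tendsto_upperbound)
      show "((\<lambda>r. \<Sum>i<n. e i * r ^ i) \<longlongrightarrow> (\<Sum>i<n. e i)) (at_left 1)"
        by (auto intro!: tendsto_eq_intros)
      show "\<forall>\<^sub>F r in at_left 1. (\<Sum>i<n. e i * r ^ i) \<le> c"
        using eventually_at_left_real[of 0 "1::real"] bound by (auto elim: eventually_mono)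
    qed simp
    then have "1 \<le> c"
      using e1 suminf_le_const[of e c] by (simp add: sums_iff)
    with \<open>c < 1\<close> show False by simp
  qed
  with \<open>c \<le> 1\<close> qs show ?thesis by simp
qed

text \<open>The minimizer over the larger set, which is closed under pointwise limits, has mass one
  by the previous lemma. Its optimality is kept against all of that set, so that later competitors
  can be plain sequences rather than values of type \<open>pmf\<close>.\<close>

lemma least_squares_pmf_exists:
  assumes e0: "\<And>i. 0 \<le> e i" and e1: "e sums 1"
  obtains q where "q \<in> k_monotone_pmfs k"
    "\<And>f. f \<in> k_monotone_subpmfs k \<Longrightarrow> (\<Sum>i. (pmf q i - e i)\<^sup>2) \<le> (\<Sum>i. (f i - e i)\<^sup>2)"
proof -
  have e_sq: "summable (\<lambda>i. (e i)\<^sup>2)"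
    using e1 e0 by (intro summable_square_of_summable_nonneg) (auto simp: sums_iff)
  have "(\<lambda>_. 0) \<in> k_monotone_subpmfs k"
    using fdiff_lincomb[of k 0 "\<lambda>_. 0" 0 "\<lambda>_. 0"]
    by (simp add: k_monotone_subpmfs_def k_monotone_def)
  then have ne: "k_monotone_subpmfs k \<noteq> {}"
    by blast
  have "\<exists>q\<in>k_monotone_subpmfs k. \<forall>f\<in>k_monotone_subpmfs k.
      (\<Sum>i. (q i - e i)\<^sup>2) \<le> (\<Sum>i. (f i - e i)\<^sup>2)"
  proof (rule least_squares_minimizer_exists[OF ne])
    fix f g assume "f \<in> k_monotone_subpmfs k" "g \<in> k_monotone_subpmfs k"
    then show "(\<lambda>i. (f i + g i) / 2) \<in> k_monotone_subpmfs k"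
      using subpmfs_convex_comb[of f k g "1 / 2" "1 / 2"] by (simp add: add_divide_distrib)
  qed (fact summable_square_diff[OF subpmfs_square_summable e_sq], fact subpmfs_limit)
  then obtain q where q: "q \<in> k_monotone_subpmfs k"
    and min: "\<And>f. f \<in> k_monotone_subpmfs k \<Longrightarrow> (\<Sum>i. (q i - e i)\<^sup>2) \<le> (\<Sum>i. (f i - e i)\<^sup>2)"
    by blast
  obtain q' where "pmf q' = q"
    using pmf_of_sums_one[OF _ subpmf_minimizer_sums_one[OF e0 e1 q min]] q
    by (auto simp: k_monotone_subpmfs_def)
  with q min that show ?thesis
    by (auto simp: k_monotone_subpmfs_def k_monotone_pmfs_def)
qed

section \<open>The empirical distribution and its projection\<close>

lemma empirical_sums_one:
  assumes "n \<ge> 1"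
  shows "empirical n x sums 1"
proof -
  have "(\<lambda>j. of_bool (a = j)) sums (1::real)" for a :: nat
    using sums_single[of a "\<lambda>_. 1 :: real"] by (simp add: of_bool_def eq_commute)
  then have "(\<lambda>j. (1 / real n) * (\<Sum>i<n. of_bool (x i = j))) sums ((1 / real n) * (\<Sum>i<n. 1))"
    by (intro sums_mult sums_sum)
  then show ?thesis
    using assms by (simp add: empirical_def[abs_def])
qed

lemma empirical_nonneg: "0 \<le> empirical n x j"
  by (simp add: empirical_def sum_nonneg)

lemma empirical_square_summable: "n \<ge> 1 \<Longrightarrow> summable (\<lambda>j. (empirical n x j)\<^sup>2)"
  using empirical_sums_one[of n x]
  by (intro summable_square_of_summable_nonneg empirical_nonneg) (auto simp: sums_iff)

text \<open>The estimator is chosen among the minimizers over probabilities. It attains the same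
  value as the minimizer constructed above and so inherits optimality over the larger set.\<close>

lemma k_monotone_lse_minimizer:
  fixes x :: "nat \<Rightarrow> nat"
  assumes "n \<ge> 1"
  defines "e \<equiv> empirical n x"
  shows "k_monotone_lse k n x \<in> k_monotone_pmfs k"
    and "f \<in> k_monotone_subpmfs k \<Longrightarrow>
      (\<Sum>i. (pmf (k_monotone_lse k n x) i - e i)\<^sup>2) \<le> (\<Sum>i. (f i - e i)\<^sup>2)"
proof -
  let ?L = "\<lambda>q. (l2norm (\<lambda>j. pmf q j - e j))\<^sup>2"
  have L: "?L q = (\<Sum>i. (pmf q i - e i)\<^sup>2)" if "q \<in> k_monotone_pmfs k" for q
    unfolding l2norm_def
    using summable_square_diff[OF subpmfs_square_summable[OF pmf_in_subpmfs[OF that]]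
        empirical_square_summable[OF assms(1), of x]]
    by (intro real_sqrt_pow2 suminf_nonneg) (auto simp: e_def)
  obtain q where q: "q \<in> k_monotone_pmfs k"
    and min: "\<And>f. f \<in> k_monotone_subpmfs k \<Longrightarrow> (\<Sum>i. (pmf q i - e i)\<^sup>2) \<le> (\<Sum>i. (f i - e i)\<^sup>2)"
    using least_squares_pmf_exists[of e k] empirical_nonneg empirical_sums_one[OF assms(1)]
    unfolding e_def by metis
  have "is_arg_min ?L (\<lambda>q. q \<in> k_monotone_pmfs k) q"
    unfolding is_arg_min_linorder using q min L by (auto dest: pmf_in_subpmfs)
  then have "is_arg_min ?L (\<lambda>q. q \<in> k_monotone_pmfs k) (k_monotone_lse k n x)"
    unfolding k_monotone_lse_def arg_min_on_def arg_min_def e_def by (rule someI)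
  then have lse: "k_monotone_lse k n x \<in> k_monotone_pmfs k" and "?L (k_monotone_lse k n x) \<le> ?L q"
    using q by (auto simp: is_arg_min_linorder)
  then show "k_monotone_lse k n x \<in> k_monotone_pmfs k"
    and "f \<in> k_monotone_subpmfs k \<Longrightarrow>
      (\<Sum>i. (pmf (k_monotone_lse k n x) i - e i)\<^sup>2) \<le> (\<Sum>i. (f i - e i)\<^sup>2)"
    using L[OF lse] L[OF q] min[of f] by auto
qed

text \<open>The segment from \<open>h\<close> to \<open>f\<close> stays in the convex set, so the
  inner product of \<open>h - e\<close> and \<open>f - h\<close> is nonnegative; expand the square
  of their sum \<open>f - e\<close>.\<close>

lemma k_monotone_lse_pythagoras:
  fixes x :: "nat \<Rightarrow> nat"
  assumes n: "n \<ge> 1" and f: "f \<in> k_monotone_pmfs k"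
  defines "e \<equiv> empirical n x" and "h \<equiv> pmf (k_monotone_lse k n x)"
  shows "(\<Sum>i. (pmf f i - h i)\<^sup>2) + (\<Sum>i. (h i - e i)\<^sup>2) \<le> (\<Sum>i. (pmf f i - e i)\<^sup>2)"
proof -
  have hS: "h \<in> k_monotone_subpmfs k" and fS: "pmf f \<in> k_monotone_subpmfs k"
    unfolding h_def using k_monotone_lse_minimizer(1)[OF n] f by (auto intro: pmf_in_subpmfs)
  have v: "summable (\<lambda>i. (h i - e i)\<^sup>2)" and u: "summable (\<lambda>i. (pmf f i - h i)\<^sup>2)"
    unfolding e_def
    by (intro summable_square_diff subpmfs_square_summable[OF hS] subpmfs_square_summable[OF fS]
        empirical_square_summable[OF n])+
  have "0 \<le> (\<Sum>i. (h i - e i) * (pmf f i - h i))"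
  proof (rule first_order_optimality[OF v u zero_less_one])
    fix t :: real assume "0 < t" "t \<le> 1"
    then have "(\<lambda>i. (1 - t) * h i + t * pmf f i) \<in> k_monotone_subpmfs k"
      by (intro subpmfs_convex_comb hS fS) auto
    from k_monotone_lse_minimizer(2)[OF n this, of x]
    show "(\<Sum>i. (h i - e i)\<^sup>2) \<le> (\<Sum>i. (h i - e i + t * (pmf f i - h i))\<^sup>2)"
      by (simp add: h_def e_def algebra_simps)
  qed
  then show ?thesis
    using sums_square_add_scaled[OF v u, of 1] by (simp add: sums_iff)
qed

text \<open>The projection is k-monotone, so it differs from an empirical distribution that is not;
  the second term of the Pythagorean inequality is then positive.\<close>

lemma k_monotone_lse_improves:
  assumes n: "n \<ge> 1" and f: "f \<in> k_monotone_pmfs k"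
  shows "l2norm (\<lambda>j. pmf f j - pmf (k_monotone_lse k n x) j) \<le> l2norm (\<lambda>j. pmf f j - empirical n x j)"
    and "\<not> k_monotone k (empirical n x) \<Longrightarrow>
      l2norm (\<lambda>j. pmf f j - pmf (k_monotone_lse k n x) j) < l2norm (\<lambda>j. pmf f j - empirical n x j)"
proof -
  let ?h = "pmf (k_monotone_lse k n x)" and ?e = "empirical n x"
  have lse: "k_monotone_lse k n x \<in> k_monotone_pmfs k"
    by (rule k_monotone_lse_minimizer(1)[OF n])
  have v: "summable (\<lambda>i. (?h i - ?e i)\<^sup>2)"
    by (intro summable_square_diff subpmfs_square_summable[OF pmf_in_subpmfs[OF lse]]
        empirical_square_summable[OF n])
  have "0 \<le> (\<Sum>i. (?h i - ?e i)\<^sup>2)"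
    using v by (intro suminf_nonneg) auto
  with k_monotone_lse_pythagoras[OF n f, of x]
  show "l2norm (\<lambda>j. pmf f j - ?h j) \<le> l2norm (\<lambda>j. pmf f j - ?e j)"
    by (simp add: l2norm_def)
  assume "\<not> k_monotone k ?e"
  with lse have "?h \<noteq> ?e"
    by (auto simp: k_monotone_pmfs_def)
  then obtain j where "?h j \<noteq> ?e j" by blast
  then have "0 < (\<Sum>i. (?h i - ?e i)\<^sup>2)"
    using v by (intro suminf_pos2[where i = j]) auto
  with k_monotone_lse_pythagoras[OF n f, of x]
  show "l2norm (\<lambda>j. pmf f j - ?h j) < l2norm (\<lambda>j. pmf f j - ?e j)"
    by (simp add: l2norm_def)
qed

section \<open>The sign of a centred i.i.d. sum\<close>

lemma std_normal_singleton: "measure std_normal_distribution {x} = 0"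
proof -
  have "AE y in lborel. y \<in> {x} \<longrightarrow> ennreal (std_normal_density y) = 0"
    using AE_lborel_singleton[of x] by eventually_elim simp
  then have "{x} \<in> null_sets std_normal_distribution"
    by (subst null_sets_density_iff) auto
  then show ?thesis
    by (simp add: measure_def null_setsD1)
qed

text \<open>The law is invariant under negation and has no atom at 0, so the two half-lines share
  the mass equally.\<close>

lemma cdf_std_normal_zero: "cdf std_normal_distribution 0 = 1 / 2"
proof -
  interpret real_distribution std_normal_distribution
    by (rule real_dist_normal_dist)
  have "distributed std_normal_distribution lborel (\<lambda>x. x) std_normal_density"
    by (auto simp: distributed_def distr_id2)
  from normal_density_affine[OF this, of "-1" 0]
  have "distributed std_normal_distribution lborel (\<lambda>x. - x) std_normal_density"
    by simp
  then have eq: "distr std_normal_distribution lborel uminus = std_normal_distribution"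
    by (simp add: distributed_def)
  have "prob {..0} = measure (distr std_normal_distribution lborel uminus) {..0}"
    by (simp only: eq)
  also have "\<dots> = prob (uminus -` {..0})"
    by (subst measure_distr) auto
  also have "uminus -` {..0} = {0::real..}"
    by auto
  finally have sym: "prob {..0} = prob {0..}" .
  have "prob UNIV = prob ({..0} \<union> {0<..})"
    by (rule arg_cong[where f = prob]) auto
  also have "\<dots> = prob {..0} + prob {0<..}"
    by (intro finite_measure_Union) auto
  finally have "prob {..0} + prob {0<..} = 1"
    using prob_space by simp
  moreover have "prob {0..} = prob ({0} \<union> {0<..})"
    by (rule arg_cong[where f = prob]) auto
  then have "prob {0..} = prob {0} + prob {0<..}"
    by (subst (asm) finite_measure_Union) auto
  ultimately show ?thesis
    using sym by (simp add: cdf_def std_normal_singleton)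
qed

text \<open>Since 0 is a continuity point of the normal distribution function, the central limit
  theorem applies there, and a positive scaling does not change the sign of the sum. The strict
  event is reached by complement.\<close>

lemma (in prob_space) iid_centred_sum_pos_half:
  fixes Y :: "nat \<Rightarrow> 'a \<Rightarrow> real"
  assumes indep: "indep_vars (\<lambda>i. borel) Y UNIV"
    and mean: "\<And>n. expectation (Y n) = 0"
    and sq: "\<And>n. integrable M (\<lambda>x. (Y n x)\<^sup>2)"
    and var: "\<And>n. expectation (\<lambda>x. (Y n x)\<^sup>2) = v" and "0 < v"
    and distr: "\<And>n. distr M borel (Y n) = \<mu>"
  shows "(\<lambda>n. prob {\<omega> \<in> space M. 0 < (\<Sum>i<n. Y i \<omega>)}) \<longlonglongrightarrow> 1 / 2"
proof -
  have [measurable]: "Y n \<in> borel_measurable M" for n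
    using indep unfolding indep_vars_def2 by simp
  let ?S = "\<lambda>n \<omega>. (\<Sum>i<n. Y i \<omega>)"
  have "weak_conv_m (\<lambda>n. distr M borel (\<lambda>\<omega>. ?S n \<omega> / sqrt (n * (sqrt v)\<^sup>2))) std_normal_distribution"
    using \<open>0 < v\<close> mean sq var distr indep
    by (intro central_limit_theorem_zero_mean[where \<mu> = \<mu>]) auto
  moreover have "isCont (cdf std_normal_distribution) 0"
    using real_dist_normal_dist
    by (simp add: finite_borel_measure.isCont_cdf real_distribution.finite_borel_measure_M
        std_normal_singleton)
  ultimately have "(\<lambda>n. cdf (distr M borel (\<lambda>\<omega>. ?S n \<omega> / sqrt (n * (sqrt v)\<^sup>2))) 0) \<longlonglongrightarrow> 1 / 2"
    by (auto simp: weak_conv_m_def weak_conv_def cdf_std_normal_zero)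
  \<comment> \<open>For \<open>n = 0\<close> the scale is 0, but the empty sum and its quotient are
    both 0, so the events still agree.\<close>
  moreover have "cdf (distr M borel (\<lambda>\<omega>. ?S n \<omega> / sqrt (n * (sqrt v)\<^sup>2))) 0
      = prob {\<omega> \<in> space M. ?S n \<omega> \<le> 0}" for n
    unfolding cdf_def using \<open>0 < v\<close>
    by (subst measure_distr) (auto simp: vimage_def divide_le_0_iff mult_le_0_iff intro!: arg_cong[where f = prob])
  ultimately have "(\<lambda>n. 1 - prob {\<omega> \<in> space M. ?S n \<omega> \<le> 0}) \<longlonglongrightarrow> 1 - 1 / 2"
    by (intro tendsto_diff tendsto_const) simp
  moreover have "1 - prob {\<omega> \<in> space M. ?S n \<omega> \<le> 0} = prob {\<omega> \<in> space M. 0 < ?S n \<omega>}" for n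
    by (subst prob_compl[symmetric]) (auto intro!: arg_cong[where f = prob])
  ultimately show ?thesis by simp
qed

section \<open>Asymptotic probability of violating k-monotonicity\<close>

text \<open>The event depends only on the first \<open>n\<close> observations, which form one of
  countably many lists, so it is a countable union of measurable events. Hence \<open>P\<close> can
  be arbitrary, even one involving the choice in \<open>arg_min_on\<close>.\<close>

lemma empirical_event_measurable:
  fixes X :: "nat \<Rightarrow> 'w \<Rightarrow> nat"
  assumes [measurable]: "\<And>i. X i \<in> measurable M (count_space UNIV)"
  shows "{\<omega> \<in> space M. P (empirical n (\<lambda>i. X i \<omega>))} \<in> sets M"
proof -
  have "P (empirical n (\<lambda>i. X i \<omega>)) \<longleftrightarrow>
      (\<exists>xs::nat list. P (empirical n ((!) xs)) \<and> (\<forall>i<n. X i \<omega> = xs ! i))" for \<omega>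
  proof
    let ?xs = "map (\<lambda>i. X i \<omega>) [0..<n]"
    have "empirical n ((!) ?xs) = empirical n (\<lambda>i. X i \<omega>)"
      by (simp add: empirical_def fun_eq_iff)
    moreover assume "P (empirical n (\<lambda>i. X i \<omega>))"
    ultimately show "\<exists>xs. P (empirical n ((!) xs)) \<and> (\<forall>i<n. X i \<omega> = xs ! i)"
      by (intro exI[of _ ?xs]) simp
  next
    assume "\<exists>xs. P (empirical n ((!) xs)) \<and> (\<forall>i<n. X i \<omega> = xs ! i)"
    then obtain xs where "P (empirical n ((!) xs))" "\<forall>i<n. X i \<omega> = xs ! i" by blast
    moreover from this have "empirical n (\<lambda>i. X i \<omega>) = empirical n ((!) xs)"
      by (simp add: empirical_def fun_eq_iff)
    ultimately show "P (empirical n (\<lambda>i. X i \<omega>))" by simp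
  qed
  then show ?thesis by simp measurable
qed

lemma fdiff_empirical:
  "fdiff k (empirical n x) i = (1 / real n) * (\<Sum>m<n. fdiff k (\<lambda>j. of_bool (x m = j)) i)"
  using fdiff_lincomb[of k "1 / real n" "\<lambda>j. \<Sum>m<n. of_bool (x m = j)" 0 "\<lambda>_. 0" i]
  by (simp add: empirical_def[abs_def] fdiff_sum del: sum_of_bool_eq)

text \<open>The \<open>k\<close>-th difference of the empirical distribution at \<open>i\<close> is a normalised sum of centred
  i.i.d. variables, so it has the wrong sign with probability tending to one half.\<close>

lemma liminf_prob_empirical_not_k_monotone:
  fixes X :: "nat \<Rightarrow> 'w \<Rightarrow> nat"
  assumes "prob_space M"
    and indep: "prob_space.indep_vars M (\<lambda>_. count_space UNIV) X UNIV"
    and distr: "\<And>m. distr M (count_space UNIV) (X m) = measure_pmf p"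
    and i: "i \<in> set_pmf p" "fdiff k (pmf p) i = 0"
  shows "liminf (\<lambda>n. ereal (measure M {\<omega> \<in> space M. \<not> k_monotone k (empirical n (\<lambda>m. X m \<omega>))}))
    \<ge> ereal (1 / 2)"
proof -
  interpret prob_space M by fact
  have X [measurable]: "X m \<in> measurable M (count_space UNIV)" for m
    using indep unfolding indep_vars_def2 by simp
  \<comment> \<open>The leading minus sign makes a positive sum of the
    \<open>D (X m \<omega>)\<close> a violation of the sign condition at \<open>i\<close>.\<close>
  define D where "D a = - ((- 1) ^ k * fdiff k (\<lambda>j. of_bool (a = j)) i)" for a
  have "\<bar>fdiff k (\<lambda>j. of_bool (a = j)) i\<bar> \<le> 2 ^ k * 1" for a
    by (rule abs_fdiff_le) simp
  then have D_bound: "\<bar>D a\<bar> \<le> 2 ^ k" for a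
    by (simp add: D_def abs_mult power_abs)
  have D_sq: "integrable (measure_pmf p) (\<lambda>a. (D a)\<^sup>2)"
  proof (rule measure_pmf.integrable_const_bound)
    show "AE a in measure_pmf p. norm ((D a)\<^sup>2) \<le> (2 ^ k)\<^sup>2"
      using D_bound by (auto simp: abs_le_square_iff[symmetric])
  qed simp
  have "(\<integral>a. of_bool (a = j) \<partial>measure_pmf p) = pmf p j" for j
  proof -
    have "(\<lambda>a. of_bool (a = j)) = (indicator {j} :: nat \<Rightarrow> real)"
      by (auto simp: indicator_def fun_eq_iff)
    then show ?thesis by (simp add: measure_pmf_single)
  qed
  moreover have "integrable (measure_pmf p) (\<lambda>a. of_bool (a = j) :: real)" for j
    by (rule measure_pmf.integrable_const_bound[where B = 1]) auto
  \<comment> \<open>The mean of a random point mass is the mass function of \<open>p\<close>, so the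
    mean of \<open>D\<close> is, up to sign, the k-th difference of \<open>p\<close> at
    \<open>i\<close>.\<close>
  ultimately have D_mean: "(\<integral>a. D a \<partial>measure_pmf p) = 0"
    using integral_fdiff[of "measure_pmf p" "\<lambda>a j. of_bool (a = j)" k i] i(2) by (simp add: D_def)
  define v where "v = (\<integral>a. (D a)\<^sup>2 \<partial>measure_pmf p)"
  \<comment> \<open>Since \<open>D i\<close> is -1, the variance is at least the mass at
    \<open>i\<close>. The support condition matters: for the point mass at 0 the difference vanishes
    at every i > 0, yet the empirical distribution almost surely equals \<open>p\<close> for n >
    0.\<close>
  have "0 < pmf p i"
    using i(1) by (simp add: pmf_positive)
  also have "pmf p i = (\<integral>a. indicator {i} a \<partial>measure_pmf p)"
    by (simp add: measure_pmf_single)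
  also have "\<dots> \<le> v"
    unfolding v_def
  proof (rule integral_mono[OF _ D_sq])
    show "indicator {i} a \<le> (D a)\<^sup>2" for a
      by (auto simp: indicator_def D_def fdiff_point_mass_same power_mult_distrib simp flip: power_mult)
  qed (simp add: measure_pmf.emeasure_eq_measure)
  finally have "0 < v" .
  have pull: "integrable M (\<lambda>\<omega>. g (X m \<omega>)) = integrable (measure_pmf p) g"
      "expectation (\<lambda>\<omega>. g (X m \<omega>)) = (\<integral>a. g a \<partial>measure_pmf p)" for g :: "nat \<Rightarrow> real" and m
    by (simp_all add: distr[of m, symmetric] integrable_distr_eq integral_distr)
  have "distr M borel (\<lambda>\<omega>. D (X m \<omega>)) = distr (measure_pmf p) borel D" for m
    by (subst distr[of m, symmetric]) (simp add: distr_distr comp_def)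
  then have "(\<lambda>n. prob {\<omega> \<in> space M. 0 < (\<Sum>m<n. D (X m \<omega>))}) \<longlonglongrightarrow> 1 / 2"
    using \<open>0 < v\<close> D_sq D_mean indep pull[of D] pull[of "\<lambda>a. (D a)\<^sup>2"]
    by (intro iid_centred_sum_pos_half[where v = v]) (auto simp: v_def intro: indep_vars_compose2)
  then have lim: "(\<lambda>n. ereal (prob {\<omega> \<in> space M. 0 < (\<Sum>m<n. D (X m \<omega>))})) \<longlonglongrightarrow> ereal (1 / 2)"
    by simp
  have "{\<omega> \<in> space M. 0 < (\<Sum>m<n. D (X m \<omega>))}
      \<subseteq> {\<omega> \<in> space M. \<not> k_monotone k (empirical n (\<lambda>m. X m \<omega>))}" if "n \<ge> 1" for n
  proof safe
    fix \<omega> assume pos: "0 < (\<Sum>m<n. D (X m \<omega>))" and mono: "k_monotone k (empirical n (\<lambda>m. X m \<omega>))"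
    have "(- 1) ^ k * fdiff k (empirical n (\<lambda>m. X m \<omega>)) i = - ((1 / real n) * (\<Sum>m<n. D (X m \<omega>)))"
      by (simp add: fdiff_empirical D_def sum_negf sum_distrib_left mult.left_commute)
    moreover have "0 < (1 / real n) * (\<Sum>m<n. D (X m \<omega>))"
      using that pos by simp
    ultimately have "(- 1) ^ k * fdiff k (empirical n (\<lambda>m. X m \<omega>)) i < 0"
      by linarith
    with mono show False
      by (simp add: k_monotone_def not_le[symmetric])
  qed
  then have "\<forall>\<^sub>F n in sequentially. ereal (prob {\<omega> \<in> space M. 0 < (\<Sum>m<n. D (X m \<omega>))})
      \<le> ereal (prob {\<omega> \<in> space M. \<not> k_monotone k (empirical n (\<lambda>m. X m \<omega>))})"
    by (intro eventually_sequentiallyI[of 1])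
       (simp add: finite_measure_mono empirical_event_measurable[OF X, where P = "\<lambda>e. \<not> k_monotone k e"])
  from Liminf_mono[OF this] lim_imp_Liminf[OF _ lim] show ?thesis
    by simp
qed

theorem theorem3:
  fixes k :: nat and p :: "nat pmf" and M :: "'w measure" and X :: "nat \<Rightarrow> 'w \<Rightarrow> nat"
  assumes "k \<ge> 2"
    and "prob_space M"
    and "prob_space.indep_vars M (\<lambda>_. count_space UNIV) X UNIV"
    and "\<And>i. distr M (count_space UNIV) (X i) = measure_pmf p"
  shows
    "(\<forall>f\<in>k_monotone_pmfs k. \<forall>n\<ge>1. \<forall>\<omega>\<in>space M.
        l2norm (\<lambda>j. pmf f j - pmf (k_monotone_lse k n (\<lambda>i. X i \<omega>)) j)
          \<le> l2norm (\<lambda>j. pmf f j - empirical n (\<lambda>i. X i \<omega>) j) \<and>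
        (\<not> k_monotone k (empirical n (\<lambda>i. X i \<omega>)) \<longrightarrow>
          l2norm (\<lambda>j. pmf f j - pmf (k_monotone_lse k n (\<lambda>i. X i \<omega>)) j)
            < l2norm (\<lambda>j. pmf f j - empirical n (\<lambda>i. X i \<omega>) j))) \<and>
     (p \<in> k_monotone_pmfs k \<and> (\<exists>i\<in>set_pmf p. fdiff k (pmf p) i = 0) \<longrightarrow>
      (\<forall>f\<in>k_monotone_pmfs k.
        liminf (\<lambda>n. ereal (measure M {\<omega> \<in> space M.
          l2norm (\<lambda>j. pmf f j - pmf (k_monotone_lse k n (\<lambda>i. X i \<omega>)) j)
            < l2norm (\<lambda>j. pmf f j - empirical n (\<lambda>i. X i \<omega>) j)}))
        \<ge> ereal (1 / 2)))"
proof (intro conjI ballI allI impI)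
  fix f \<omega> and n :: nat assume "f \<in> k_monotone_pmfs k" "1 \<le> n" "\<omega> \<in> space M"
  then show "l2norm (\<lambda>j. pmf f j - pmf (k_monotone_lse k n (\<lambda>i. X i \<omega>)) j)
      \<le> l2norm (\<lambda>j. pmf f j - empirical n (\<lambda>i. X i \<omega>) j)"
    and "\<not> k_monotone k (empirical n (\<lambda>i. X i \<omega>)) \<Longrightarrow>
      l2norm (\<lambda>j. pmf f j - pmf (k_monotone_lse k n (\<lambda>i. X i \<omega>)) j)
        < l2norm (\<lambda>j. pmf f j - empirical n (\<lambda>i. X i \<omega>) j)"
    by (simp_all add: k_monotone_lse_improves)
next
  interpret prob_space M by fact
  fix f assume "p \<in> k_monotone_pmfs k \<and> (\<exists>i\<in>set_pmf p. fdiff k (pmf p) i = 0)"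
    and f: "f \<in> k_monotone_pmfs k"
  then obtain i where i: "i \<in> set_pmf p" "fdiff k (pmf p) i = 0" by blast
  let ?E = "\<lambda>n. {\<omega> \<in> space M. l2norm (\<lambda>j. pmf f j - pmf (k_monotone_lse k n (\<lambda>i. X i \<omega>)) j)
    < l2norm (\<lambda>j. pmf f j - empirical n (\<lambda>i. X i \<omega>) j)}"
  have X: "X m \<in> measurable M (count_space UNIV)" for m
    using assms(3) unfolding indep_vars_def2 by simp
  have "?E n \<in> sets M" for n
    \<comment> \<open>Unfolding exposes the estimator as a function of the empirical sequence alone,
      so the event has the shape \<open>P (empirical n _)\<close>.\<close>
    unfolding k_monotone_lse_def
    by (rule empirical_event_measurable[OF X, where P = "\<lambda>e. l2norm (\<lambda>j. pmf f j -
      pmf (arg_min_on (\<lambda>q. (l2norm (\<lambda>j. pmf q j - e j))\<^sup>2) (k_monotone_pmfs k)) j)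
      < l2norm (\<lambda>j. pmf f j - e j)"])
  then have "\<forall>\<^sub>F n in sequentially.
      ereal (prob {\<omega> \<in> space M. \<not> k_monotone k (empirical n (\<lambda>m. X m \<omega>))}) \<le> ereal (prob (?E n))"
    using f by (intro eventually_sequentiallyI[of 1])
      (auto intro!: finite_measure_mono k_monotone_lse_improves)
  from Liminf_mono[OF this] liminf_prob_empirical_not_k_monotone[OF assms(2-4) i]
  show "ereal (1 / 2) \<le> liminf (\<lambda>n. ereal (prob (?E n)))"
    by (rule order_trans[rotated])
qed

end
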